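(* There exist a map $g:\mathbb{R}^d\to\mathbb{R}^n$ with $\mathcal{Z}=\operatorname{cl}\{g(\theta):\theta\in\mathbb{R}^d\}$ convex, an operator $F:\mathcal{Z}\to\mathbb{R}^n$ that is $L$-Lipschitz and $\mu$-strongly monotone for some $L,\mu>0$ and for which the variational inequality "$\langle F(z_\ast),z-z_\ast\rangle\ge0$ for all $z\in\mathcal{Z}$" has a solution $z_\ast\in\operatorname{ri}\mathcal{Z}$, and a constant $\alpha<1$ such that, for every $\eta>0$, there is a sequence $\{z_t=g(\theta_t)\}_{t\in\mathbb{N}}$ verifying the $\alpha$-descent condition with this $\alpha$ and this $\eta$ which diverges.
   Context: $\|\cdot\|$, $\langle\cdot,\cdot\rangle$ are Euclidean; $\operatorname{cl}$, $\operatorname{ri}$ denote closure and relative interior. $L$-Lipschitz: $\|F(x)-F(y)\|\le L\|x-y\|$; $\mu$-strongly monotone: $\langle F(x)-F(y),x-y\rangle\ge\mu\|x-y\|^2$, for all $x,y\in\mathcal{Z}$. $\alpha$-descent condition: given $\eta>0$ and $\alpha\in[0,1)$, let $\ell_t(\theta)=\frac12\|g(\theta)-[g(\theta_t)-\eta F(g(\theta_t))]\|^2$ and $\ell_t^\ast=\inf_{\theta\in\mathbb{R}^d}\ell_t(\theta)$. The trajectory $\{\theta_t\}_{t\in\mathbb{N}}$ (and the iterates $z_t=g(\theta_t)$) satisfies the condition if $\ell_t(\theta_{t+1})-\ell_t^\ast\le\alpha^2(\ell_t(\theta_t)-\ell_t^\ast)$ for every $t$. A sequence diverges if it does not converge.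 *)

theory Defs
  imports "HOL-Analysis.Analysis"
begin

text \<open>
  The dimensions d and n are existentially quantified, so they cannot be carried by types.
  All the spaces \<open>\<real>\<^sup>n\<close> are therefore realised as the coordinate subspaces \<open>Rn n\<close>
  of one inner product space, the finitely supported real sequences with
  \<open>\<langle>x, y\<rangle> = (\<Sum>i. x i * y i)\<close>. The library notions of norm, closure, convexity,
  relative interior, Lipschitz continuity and convergence then apply directly. The lemmas
  \<open>inner_Rn\<close>, \<open>norm_Rn\<close>, \<open>coord_surj_Rn\<close> and \<open>closed_Rn\<close> show that on \<open>Rn n\<close> these
  are the notions of Euclidean n-space.
\<close>

typedef fin_seq = "{x :: nat \<Rightarrow> real. finite {i. x i \<noteq> 0}}"
  morphisms coord Abs_fin_seq
  by (intro exI[of _ "\<lambda>_. 0"]) simp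

lemma finite_support: "finite {i. coord x i \<noteq> 0}"
  using coord[of x] by simp

lemma coord_Abs: "finite {i. f i \<noteq> 0} \<Longrightarrow> coord (Abs_fin_seq f) = f"
  by (simp add: Abs_fin_seq_inverse)

lemma fin_seq_eqI: "(\<And>i. coord x i = coord y i) \<Longrightarrow> x = y"
  by (metis coord_inject ext)

instantiation fin_seq :: real_vector
begin

definition "0 = Abs_fin_seq (\<lambda>_. 0)"
definition "x + y = Abs_fin_seq (\<lambda>i. coord x i + coord y i)"
definition "- x = Abs_fin_seq (\<lambda>i. - coord x i)"
definition "x - y = Abs_fin_seq (\<lambda>i. coord x i - coord y i)"
definition "scaleR r x = Abs_fin_seq (\<lambda>i. r * coord x i)"

lemma coord_zero [simp]: "coord 0 i = 0"
  by (simp add: zero_fin_seq_def coord_Abs)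

lemma coord_add [simp]: "coord (x + y) i = coord x i + coord y i"
proof -
  have "finite {i. coord x i + coord y i \<noteq> 0}"
    by (rule finite_subset[OF _ finite_UnI[OF finite_support[of x] finite_support[of y]]]) auto
  then show ?thesis by (simp add: plus_fin_seq_def coord_Abs)
qed

lemma coord_minus [simp]: "coord (- x) i = - coord x i"
  using finite_support[of x] by (simp add: uminus_fin_seq_def coord_Abs)

lemma coord_diff [simp]: "coord (x - y) i = coord x i - coord y i"
proof -
  have "finite {i. coord x i - coord y i \<noteq> 0}"
    by (rule finite_subset[OF _ finite_UnI[OF finite_support[of x] finite_support[of y]]]) auto
  then show ?thesis by (simp add: minus_fin_seq_def coord_Abs)
qed

lemma coord_scaleR [simp]: "coord (scaleR r x) i = r * coord x i"
proof -
  have "finite {i. r * coord x i \<noteq> 0}"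
    by (rule finite_subset[OF _ finite_support[of x]]) auto
  then show ?thesis by (simp add: scaleR_fin_seq_def coord_Abs)
qed

instance
  by standard (auto intro!: fin_seq_eqI simp: algebra_simps)

end

instantiation fin_seq :: real_inner
begin

definition "inner x y = (\<Sum>i | coord x i \<noteq> 0. coord x i * coord y i)"
definition "norm (x :: fin_seq) = sqrt (inner x x)"
definition "sgn (x :: fin_seq) = x /\<^sub>R norm x"
definition "dist (x :: fin_seq) y = norm (x - y)"
definition [code del]:
  "(uniformity :: (fin_seq \<times> fin_seq) filter) = (INF e\<in>{0 <..}. principal {(x, y). dist x y < e})"
definition [code del]:
  "open (U :: fin_seq set) \<longleftrightarrow> (\<forall>x\<in>U. eventually (\<lambda>(x', y). x' = x \<longrightarrow> y \<in> U) uniformity)"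

lemma inner_fin_seq_superset:
  assumes "finite A" "{i. coord x i \<noteq> 0} \<subseteq> A"
  shows "inner x y = (\<Sum>i\<in>A. coord x i * coord y i)"
  unfolding inner_fin_seq_def by (rule sum.mono_neutral_left) (use assms in auto)

instance
proof
  fix x y z :: fin_seq and r :: real
  define A where "A = {i. coord x i \<noteq> 0} \<union> {i. coord y i \<noteq> 0}"
  have A: "finite A" unfolding A_def using finite_support by blast
  have x: "inner x w = (\<Sum>i\<in>A. coord x i * coord w i)"
    and y: "inner y w = (\<Sum>i\<in>A. coord y i * coord w i)"
    and xy: "inner (x + y) w = (\<Sum>i\<in>A. coord (x + y) i * coord w i)"
    and rx: "inner (scaleR r x) w = (\<Sum>i\<in>A. coord (scaleR r x) i * coord w i)" for w
    by (rule inner_fin_seq_superset[OF A], force simp: A_def)+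
  show "inner x y = inner y x" by (simp add: x y mult.commute)
  show "inner (x + y) z = inner x z + inner y z"
    by (simp add: x y xy sum.distrib algebra_simps)
  show "inner (scaleR r x) y = r * inner x y"
    by (simp add: x rx sum_distrib_left algebra_simps)
  show "0 \<le> inner x x" by (simp add: x sum_nonneg)
  show "inner x x = 0 \<longleftrightarrow> x = 0"
  proof
    assume "inner x x = 0"
    then have "\<forall>i\<in>A. coord x i * coord x i = 0"
      unfolding x by (subst (asm) sum_nonneg_eq_0_iff[OF A]) auto
    then have "coord x i = 0" if "i \<in> A" for i
      using that by simp
    then have "coord x i = 0" for i
      unfolding A_def by blast
    then show "x = 0" by (intro fin_seq_eqI) simp
  qed (simp add: inner_fin_seq_def)
qed (rule norm_fin_seq_def sgn_fin_seq_def dist_fin_seq_def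
      uniformity_fin_seq_def open_fin_seq_def)+

end

definition Rn :: "nat \<Rightarrow> fin_seq set" where
  "Rn n = {x. \<forall>i\<ge>n. coord x i = 0}"

lemma inner_Rn: "x \<in> Rn n \<Longrightarrow> inner x y = (\<Sum>i<n. coord x i * coord y i)"
  by (rule inner_fin_seq_superset) (auto simp: Rn_def intro: leI)

lemma norm_Rn: "x \<in> Rn n \<Longrightarrow> norm x = sqrt (\<Sum>i<n. (coord x i)\<^sup>2)"
  by (simp add: norm_fin_seq_def inner_Rn power2_eq_square)

lemma coord_surj_Rn: "\<exists>!x. x \<in> Rn n \<and> (\<forall>i<n. coord x i = f i)"
proof -
  define x where "x = Abs_fin_seq (\<lambda>i. if i < n then f i else 0)"
  have "finite {i. (if i < n then f i else 0) \<noteq> 0}"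
    by (rule finite_subset[of _ "{..<n}"]) auto
  then have x: "coord x i = (if i < n then f i else 0)" for i
    by (simp add: x_def coord_Abs)
  show ?thesis
  proof (rule ex1I[of _ x])
    show "x \<in> Rn n \<and> (\<forall>i<n. coord x i = f i)"
      by (simp add: x Rn_def)
    show "y = x" if y: "y \<in> Rn n \<and> (\<forall>i<n. coord y i = f i)" for y
    proof (rule fin_seq_eqI)
      show "coord y i = coord x i" for i
        using y by (cases "i < n") (simp_all add: x Rn_def)
    qed
  qed
qed

lemma abs_coord_le_norm: "\<bar>coord x i\<bar> \<le> norm x"
proof (cases "coord x i = 0")
  case False
  have "(coord x i)\<^sup>2 \<le> inner x x"
    unfolding inner_fin_seq_def power2_eq_square
    by (rule member_le_sum) (use False finite_support in auto)
  then show ?thesis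
    by (metis norm_fin_seq_def real_sqrt_abs real_sqrt_le_iff)
qed simp

lemma closed_Rn: "closed (Rn n)"
proof -
  have "bounded_linear (\<lambda>x. coord x i)" for i
    by (rule bounded_linear_intro[where K = 1]) (auto simp: abs_coord_le_norm)
  then have "closed {x. coord x i = 0}" for i
    by (intro closed_Collect_eq continuous_intros)
       (auto intro: linear_continuous_on)
  then have "closed (\<Inter>i\<in>{n..}. {x. coord x i = 0})" by blast
  moreover have "Rn n = (\<Inter>i\<in>{n..}. {x. coord x i = 0})" by (auto simp: Rn_def)
  ultimately show ?thesis by simp
qed

definition strongly_monotone_on ::
  "real \<Rightarrow> 'a::real_inner set \<Rightarrow> ('a \<Rightarrow> 'a) \<Rightarrow> bool" where
  "strongly_monotone_on \<mu> Z F \<longleftrightarrow>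
     (\<forall>x\<in>Z. \<forall>y\<in>Z. inner (F x - F y) (x - y) \<ge> \<mu> * (norm (x - y))\<^sup>2)"

definition VI_solution :: "'a::real_inner set \<Rightarrow> ('a \<Rightarrow> 'a) \<Rightarrow> 'a \<Rightarrow> bool" where
  "VI_solution Z F zs \<longleftrightarrow> zs \<in> Z \<and> (\<forall>z\<in>Z. inner (F zs) (z - zs) \<ge> 0)"

text \<open>\<open>surrogate g F \<eta> \<theta>\<^sub>t\<close> is the function \<open>\<ell>\<^sub>t\<close>, which depends on t only through \<open>\<theta>\<^sub>t\<close>.\<close>

definition surrogate ::
  "('p \<Rightarrow> 'a::real_inner) \<Rightarrow> ('a \<Rightarrow> 'a) \<Rightarrow> real \<Rightarrow> 'p \<Rightarrow> 'p \<Rightarrow> real" where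
  "surrogate g F \<eta> \<theta>\<^sub>t \<theta> = 1/2 * (norm (g \<theta> - (g \<theta>\<^sub>t - \<eta> *\<^sub>R F (g \<theta>\<^sub>t))))\<^sup>2"

definition surrogate_inf ::
  "'p set \<Rightarrow> ('p \<Rightarrow> 'a::real_inner) \<Rightarrow> ('a \<Rightarrow> 'a) \<Rightarrow> real \<Rightarrow> 'p \<Rightarrow> real" where
  "surrogate_inf \<Theta> g F \<eta> \<theta>\<^sub>t = (INF \<theta>\<in>\<Theta>. surrogate g F \<eta> \<theta>\<^sub>t \<theta>)"

definition descent_condition ::
  "'p set \<Rightarrow> ('p \<Rightarrow> 'a::real_inner) \<Rightarrow> ('a \<Rightarrow> 'a) \<Rightarrow> real \<Rightarrow> real \<Rightarrow> (nat \<Rightarrow> 'p) \<Rightarrow> bool" where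
  "descent_condition \<Theta> g F \<eta> \<alpha> \<theta> \<longleftrightarrow>
     (\<forall>t. surrogate g F \<eta> (\<theta> t) (\<theta> (Suc t)) - surrogate_inf \<Theta> g F \<eta> (\<theta> t)
        \<le> \<alpha>\<^sup>2 * (surrogate g F \<eta> (\<theta> t) (\<theta> t) - surrogate_inf \<Theta> g F \<eta> (\<theta> t)))"

end

theory Submission
  imports Defs
begin

text \<open>
  Take \<open>d = n = 2\<close>, \<open>g = id\<close>, so that \<open>Z\<close> is the plane, and \<open>F z = z + J z\<close> with \<open>J\<close> the rotation
  by a right angle. Since \<open>J z\<close> is orthogonal to \<open>z\<close> and of the same length, \<open>F\<close> is strongly
  monotone with solution 0, and \<open>\<parallel>F z\<parallel>\<^sup>2 = 2 \<parallel>z\<parallel>\<^sup>2\<close>. The step \<open>z\<^sub>t\<^sub>+\<^sub>1 = z\<^sub>t - \<eta> J z\<^sub>t\<close> misses the target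
  \<open>z\<^sub>t - \<eta> F z\<^sub>t\<close> by \<open>\<eta> z\<^sub>t\<close>, which is the fraction \<open>1 / \<surd>2\<close> of
  \<open>\<eta> \<parallel>F z\<^sub>t\<parallel>\<close> in length, whatever \<open>\<eta>\<close> is; and it multiplies \<open>\<parallel>z\<^sub>t\<parallel>\<^sup>2\<close> by \<open>1 + \<eta>\<^sup>2\<close>.
\<close>

lemma subspace_Rn: "subspace (Rn n)"
  by (simp add: subspace_def Rn_def)

text \<open>A subspace is its own affine hull, hence open relative to it. The type class is general
  because \<open>fin_seq\<close> is infinite-dimensional.\<close>

lemma rel_interior_subspace:
  fixes S :: "'a::real_normed_vector set"
  assumes "subspace S"
  shows "rel_interior S = S"
proof -
  have "affine hull S = S"
    using assms by (simp add: affine_hull_eq subspace_imp_affine)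
  then show ?thesis
    unfolding rel_interior_def by (auto simp del: affine_hull_eq intro!: exI[of _ S])
qed

text \<open>The quarter turn \<open>J\<close> of the first two coordinates. All later ones are
  dropped, so it is an isometry on \<open>Rn 2\<close> only.\<close>

definition rot :: "fin_seq \<Rightarrow> fin_seq" where
  "rot z = Abs_fin_seq (\<lambda>i. if i = 0 then - coord z 1 else if i = 1 then coord z 0 else 0)"

lemma coord_rot:
  "coord (rot z) i = (if i = 0 then - coord z 1 else if i = 1 then coord z 0 else 0)"
proof -
  have "finite {i::nat. (if i = 0 then - coord z 1 else if i = 1 then coord z 0 else 0) \<noteq> 0}"
    by (rule finite_subset[of _ "{0, 1}"]) (auto split: if_splits)
  then show ?thesis by (simp add: rot_def coord_Abs)
qed

lemma rot_in_Rn: "rot z \<in> Rn 2"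
  by (simp add: Rn_def coord_rot)

lemma rot_diff: "rot (x - y) = rot x - rot y"
  by (rule fin_seq_eqI) (simp add: coord_rot)

lemma rot_zero: "rot 0 = 0"
  by (rule fin_seq_eqI) (simp add: coord_rot)

lemma inner_rot: "z \<in> Rn 2 \<Longrightarrow> inner z (rot z) = 0"
  by (simp add: inner_Rn coord_rot numeral_2_eq_2)

lemma norm_rot: "z \<in> Rn 2 \<Longrightarrow> norm (rot z) = norm z"
  by (simp add: norm_Rn[OF rot_in_Rn] norm_Rn[of z] coord_rot eval_nat_numeral add.commute)

text \<open>Pythagoras, as \<open>rot z\<close> is orthogonal to \<open>z\<close> and equally long.
  \<open>c = - \<eta>\<close> gives the growth of the iterates, \<open>c = 1\<close> the length of
  \<open>F z\<close>.\<close>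

lemma norm_add_scaleR_rot:
  assumes "z \<in> Rn 2"
  shows "(norm (z + c *\<^sub>R rot z))\<^sup>2 = (1 + c\<^sup>2) * (norm z)\<^sup>2"
proof -
  have "(norm (z + c *\<^sub>R rot z))\<^sup>2 = (norm z)\<^sup>2 + (norm (c *\<^sub>R rot z))\<^sup>2"
    using inner_rot[OF assms] by (intro norm_add_Pythagorean) (simp add: orthogonal_def)
  also have "\<dots> = (1 + c\<^sup>2) * (norm z)\<^sup>2"
    by (simp add: norm_rot[OF assms] power_mult_distrib distrib_right)
  finally show ?thesis .
qed

text \<open>The loss is half a squared distance to the target, so a parameter that hits the target
  attains the lower bound 0.\<close>

lemma surrogate_inf_attained:
  assumes "\<theta>' \<in> \<Theta>" "g \<theta>' = g \<theta> - \<eta> *\<^sub>R F (g \<theta>)"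
  shows "surrogate_inf \<Theta> g F \<eta> \<theta> = 0"
proof (rule antisym)
  have nn: "0 \<le> surrogate g F \<eta> \<theta> x" for x
    by (simp add: surrogate_def)
  have "surrogate_inf \<Theta> g F \<eta> \<theta> \<le> surrogate g F \<eta> \<theta> \<theta>'"
    unfolding surrogate_inf_def by (intro cINF_lower bdd_belowI2[where m = 0] nn assms)
  also have "\<dots> = 0" by (simp add: surrogate_def assms)
  finally show "surrogate_inf \<Theta> g F \<eta> \<theta> \<le> 0" .
  show "0 \<le> surrogate_inf \<Theta> g F \<eta> \<theta>"
    unfolding surrogate_inf_def using assms(1) by (intro cINF_greatest nn) auto
qed

text \<open>The squared norms grow geometrically, whereas a convergent sequence is bounded.\<close>

lemma not_convergent_if_norm_grows:
  fixes z :: "nat \<Rightarrow> 'a::real_normed_vector"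
  assumes "c > 1" "z 0 \<noteq> 0" "\<And>t. (norm (z (Suc t)))\<^sup>2 = c * (norm (z t))\<^sup>2"
  shows "\<not> convergent z"
proof
  assume "convergent z"
  then have "Bseq z" by (rule convergent_imp_Bseq)
  then obtain K where K: "\<And>t. norm (z t) \<le> K"
    by (auto simp: Bseq_def)
  have growth: "(norm (z t))\<^sup>2 = c ^ t * (norm (z 0))\<^sup>2" for t
    by (induction t) (simp_all add: assms(3))
  obtain t where "K\<^sup>2 / (norm (z 0))\<^sup>2 < c ^ t"
    using real_arch_pow assms(1) by blast
  then have "K\<^sup>2 < (norm (z t))\<^sup>2"
    unfolding growth[of t] using assms(2) by (simp add: pos_divide_less_eq)
  moreover have "(norm (z t))\<^sup>2 \<le> K\<^sup>2"
    using K by (intro power_mono) auto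
  ultimately show False by simp
qed

theorem proposition3p3:
  shows "\<exists>(d::nat) (n::nat) (g :: fin_seq \<Rightarrow> fin_seq) (F :: fin_seq \<Rightarrow> fin_seq) (Z :: fin_seq set) (\<alpha>::real).
    g \<in> Rn d \<rightarrow> Rn n \<and>
    Z = closure (g ` Rn d) \<and>
    convex Z \<and>
    F \<in> Z \<rightarrow> Rn n \<and>
    (\<exists>L>0. L-lipschitz_on Z F) \<and>
    (\<exists>\<mu>>0. strongly_monotone_on \<mu> Z F) \<and>
    (\<exists>zs\<in>rel_interior Z. VI_solution Z F zs) \<and>
    0 \<le> \<alpha> \<and> \<alpha> < 1 \<and>
    (\<forall>\<eta>>0. \<exists>\<theta> :: nat \<Rightarrow> fin_seq.
       (\<forall>t. \<theta> t \<in> Rn d) \<and>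
       descent_condition (Rn d) g F \<eta> \<alpha> \<theta> \<and>
       \<not> convergent (\<lambda>t. g (\<theta> t)))"
proof -
  define F where "F z = z + rot z" for z
  \<comment> \<open>Additivity reduces the Lipschitz and monotonicity bounds to the single vector
    \<open>x - y\<close>.\<close>
  have F_diff: "F x - F y = F (x - y)" for x y
    by (simp add: F_def rot_diff)
  have F_Rn: "F z \<in> Rn 2" if "z \<in> Rn 2" for z
    unfolding F_def using that rot_in_Rn subspace_Rn by (blast intro: subspace_add)
  have diff_Rn: "x - y \<in> Rn 2" if "x \<in> Rn 2" "y \<in> Rn 2" for x y
    using that subspace_Rn by (blast intro: subspace_diff)
  have scale_Rn: "c *\<^sub>R x \<in> Rn 2" if "x \<in> Rn 2" for x c
    using that subspace_Rn by (blast intro: subspace_scale)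
  have lipschitz: "2-lipschitz_on (Rn 2) F"
  proof (rule lipschitz_onI)
    fix x y assume xy: "x \<in> Rn 2" "y \<in> Rn 2"
    have "norm (F (x - y)) \<le> norm (x - y) + norm (rot (x - y))"
      unfolding F_def by (rule norm_triangle_ineq)
    also have "\<dots> = 2 * norm (x - y)"
      using norm_rot diff_Rn[OF xy] by simp
    finally show "dist (F x) (F y) \<le> 2 * dist x y"
      by (simp add: dist_norm F_diff)
  qed simp
  have monotone: "strongly_monotone_on 1 (Rn 2) F"
    unfolding strongly_monotone_on_def F_diff
    using diff_Rn inner_rot
    by (simp add: F_def inner_add_left inner_commute[of "rot _"] power2_norm_eq_inner)
  have trajectory: "\<exists>\<theta>. (\<forall>t. \<theta> t \<in> Rn 2) \<and> descent_condition (Rn 2) id F \<eta> (sqrt (1/2)) \<theta> \<and>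
      \<not> convergent (\<lambda>t. id (\<theta> t))" if "\<eta> > 0" for \<eta>
  proof -
    \<comment> \<open>Any nonzero starting point would do; this one is (1, 1).\<close>
    obtain e where e: "e \<in> Rn 2" "\<And>i. i < 2 \<Longrightarrow> coord e i = 1"
      using coord_surj_Rn[of 2 "\<lambda>_. 1"] by blast
    have "e \<noteq> 0" using e(2)[of 0] by auto
    define \<theta> where "\<theta> t = ((\<lambda>z. z - \<eta> *\<^sub>R rot z) ^^ t) e" for t
    have \<theta>0: "\<theta> 0 = e" and \<theta>Suc: "\<theta> (Suc t) = \<theta> t - \<eta> *\<^sub>R rot (\<theta> t)" for t
      by (simp_all add: \<theta>_def)
    have \<theta>: "\<theta> t \<in> Rn 2" for t
      by (induction t) (simp_all add: \<theta>0 \<theta>Suc e(1) diff_Rn scale_Rn rot_in_Rn)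
    have growth: "(norm (\<theta> (Suc t)))\<^sup>2 = (1 + \<eta>\<^sup>2) * (norm (\<theta> t))\<^sup>2" for t
      using norm_add_scaleR_rot[OF \<theta>[of t], of "- \<eta>"] by (simp add: \<theta>Suc)
    have inf: "surrogate_inf (Rn 2) id F \<eta> (\<theta> t) = 0" for t
      by (rule surrogate_inf_attained[where \<theta>' = "\<theta> t - \<eta> *\<^sub>R F (\<theta> t)"])
         (simp_all add: \<theta> diff_Rn scale_Rn F_Rn)
    \<comment> \<open>The step omits the part \<open>- \<eta> *\<^sub>R \<theta> t\<close> of the
      target, so the residual is \<open>\<eta> *\<^sub>R \<theta> t\<close>.\<close>
    have "surrogate id F \<eta> (\<theta> t) (\<theta> (Suc t)) = \<eta>\<^sup>2 / 2 * (norm (\<theta> t))\<^sup>2" for t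
      by (simp add: surrogate_def \<theta>Suc F_def algebra_simps)
    moreover have "surrogate id F \<eta> (\<theta> t) (\<theta> t) = \<eta>\<^sup>2 * (norm (\<theta> t))\<^sup>2" for t
      using norm_add_scaleR_rot[OF \<theta>[of t], of 1]
      by (simp add: surrogate_def F_def power_mult_distrib)
    \<comment> \<open>Both losses scale with the square of \<eta>, so their ratio 1/2, which is the
      square of \<alpha>, serves every \<eta>.\<close>
    ultimately have "descent_condition (Rn 2) id F \<eta> (sqrt (1/2)) \<theta>"
      by (simp add: descent_condition_def inf real_sqrt_divide power_divide)
    moreover have "\<not> convergent \<theta>"
      by (rule not_convergent_if_norm_grows[where c = "1 + \<eta>\<^sup>2"])
         (use that \<open>e \<noteq> 0\<close> \<theta>0 growth in auto)
    ultimately show ?thesis using \<theta> by auto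
  qed
  \<comment> \<open>At 0 the operator vanishes, so the inequality is an equality.\<close>
  have solution: "\<exists>zs\<in>rel_interior (Rn 2). VI_solution (Rn 2) F zs"
    by (rule bexI[of _ 0])
       (simp_all add: VI_solution_def F_def rot_zero rel_interior_subspace subspace_Rn subspace_0)
  show ?thesis
  proof (rule exI[of _ 2], rule exI[of _ 2], rule exI[of _ id], rule exI[of _ F],
      rule exI[of _ "Rn 2"], rule exI[of _ "sqrt (1/2)"], intro conjI)
    show "\<exists>L>0. L-lipschitz_on (Rn 2) F"
      using lipschitz by (intro exI[of _ 2]) simp
    show "\<exists>\<mu>>0. strongly_monotone_on \<mu> (Rn 2) F"
      using monotone by (intro exI[of _ 1]) simp
    show "\<forall>\<eta>>0. \<exists>\<theta>. (\<forall>t. \<theta> t \<in> Rn 2) \<and> descent_condition (Rn 2) id F \<eta> (sqrt (1/2)) \<theta> \<and>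
        \<not> convergent (\<lambda>t. id (\<theta> t))"
      using trajectory by blast
  qed (simp_all add: solution F_Rn closed_Rn subspace_Rn subspace_imp_convex)
qed

end
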